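(* Let $j\in\{\tfrac12,1,\tfrac32,\dots\}$ and $W_{\min}\in[\min_m\Delta_{j,m},\tfrac{1}{2j+1}]$. Let $\mathcal P_{W_{\min}}$ be the AWB polytope associated with $W_{\min}$, and let $r_{\mathrm{in}}^{W_{\min}}$ be the largest $r\ge 0$ such that the ball $\{\boldsymbol\lambda\in\mathbb R^{2j+1}:\sum_i\lambda_i=1,\ \lVert\boldsymbol\lambda-\boldsymbol\lambda_0\rVert\le r\}$ centred at the spectrum $\boldsymbol\lambda_0=\tfrac1{2j+1}(1,\dots,1)$ of the maximally mixed state is contained in $\mathcal P_{W_{\min}}$. Suppose that $W_{\min}$ is such that this largest ball is contained in the state simplex $\{\boldsymbol\lambda\in\mathbb R^{2j+1}:\lambda_i\ge0,\ \sum_i\lambda_i=1\}$. Then $$r_{\mathrm{in}}^{W_{\min}}=\frac{1-(2j+1)W_{\min}}{2\sqrt{j(2j+1)(j+1)}}.$$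
   Context: A spin-$j$ state is a positive semidefinite operator $\rho$ of trace $1$ on $\mathbb C^{2j+1}$ (with Dicke basis $|j,m\rangle$, $m=-j,\dots,j$, of the spin-$j$ irreducible representation of $\mathrm{SU}(2)$). The maximally mixed state is $\rho_0=\mathbb 1/(2j+1)$. The Hilbert–Schmidt distance $r(\rho)=\sqrt{\mathrm{Tr}[(\rho-\rho_0)^2]}$ from $\rho$ to $\rho_0$ equals the Euclidean distance $\lVert\boldsymbol\lambda-\boldsymbol\lambda_0\rVert$ between the spectra $\boldsymbol\lambda$ of $\rho$ and $\boldsymbol\lambda_0$ of $\rho_0$. The spin-$j$ Wigner kernel eigenvalues are $$\Delta_{j,m}=\sum_{L=0}^{2j}\frac{2L+1}{2j+1}\,C^{j,m}_{j,m;L,0},\qquad m=-j,\dots,j,$$ with $C^{J,M}_{j_1,m_1;j_2,m_2}$ the Clebsch–Gordan coefficients; list them as $(\Delta_0,\dots,\Delta_{2j})=(\Delta_{j,-j},\dots,\Delta_{j,j})$. The Wigner kernel is $\Delta(\Omega)=U_g\big(\sum_m\Delta_{j,m}|j,m\rangle\langle j,m|\big)U_g^\dagger$, where $g\in\mathrm{SU}(2)$ rotates the North pole to $\Omega\in S^2$, and the Wigner function of $\rho$ is $W_\rho(\Omega)=\mathrm{Tr}[\rho\Delta(\Omega)]$. A state $\rho$ is absolutely Wigner bounded (AWB) with respect to $W_{\min}$ if $W_{U\rho U^\dagger}(\Omega)\ge W_{\min}$ for all $\Omega\in S^2$ and $U\in\mathrm{SU}(2j+1)$. The AWB polytope associated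 with $W_{\min}$ is $$\mathcal P_{W_{\min}}=\Big\{\boldsymbol\lambda\in\mathbb R^{2j+1}:\ \sum_{i=0}^{2j}\lambda_i=1,\ \ \sum_{i=0}^{2j}\lambda_i\Delta_{\pi(i)}\ge W_{\min}\ \text{for all permutations }\pi\text{ of }\{0,\dots,2j\}\Big\}.$$ A state is AWB with respect to $W_{\min}$ if and only if its spectrum lies in $\mathcal P_{W_{\min}}$. For negative $W_{\min}$ the polytope may extend beyond the state simplex. *)

theory Defs
  imports "HOL-Analysis.Analysis"
begin

section \<open>Clebsch-Gordan coefficients\<close>

text \<open>
  Spins and magnetic quantum numbers are real numbers. For \<open>x \<in> \<nat>\<close> one has \<open>x! = Gamma (x + 1)\<close>
  and \<open>1 / x! = rGamma (x + 1)\<close>; the latter vanishes at the negative integers, which is the usual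
  convention for the terms of Racah's sum.
\<close>

definition cg_admissible :: "real \<Rightarrow> real \<Rightarrow> real \<Rightarrow> real \<Rightarrow> real \<Rightarrow> real \<Rightarrow> bool" where
  "cg_admissible j1 m1 j2 m2 J M \<longleftrightarrow>
     {j1 + m1, j1 - m1, j2 + m2, j2 - m2, J + M, J - M} \<subseteq> \<nat> \<and>
     {j1 + j2 - J, J + j1 - j2, J - j1 + j2} \<subseteq> \<nat> \<and>
     m1 + m2 = M"

text \<open>
  \<open>clebsch_gordan j1 m1 j2 m2 J M\<close> is \<open>\<langle>j1 m1; j2 m2 | J M\<rangle>\<close> in the Condon-Shortley phase convention,
  given by Racah's formula. The lemmas \<open>clebsch_gordan_raise\<close>, \<open>clebsch_gordan_lower\<close>,
  \<open>clebsch_gordan_normalized\<close> and \<open>clebsch_gordan_phase\<close> below show that these numbers are the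
  coefficients of the coupled basis: the two ladder recursions, normalization of the highest
  weight vector, and positivity of its coefficient at \<open>m1 = j1\<close>.
\<close>

definition clebsch_gordan :: "real \<Rightarrow> real \<Rightarrow> real \<Rightarrow> real \<Rightarrow> real \<Rightarrow> real \<Rightarrow> real" where
  "clebsch_gordan j1 m1 j2 m2 J M =
     (if cg_admissible j1 m1 j2 m2 J M then
        sqrt ((2 * J + 1) * Gamma (J + j1 - j2 + 1) * Gamma (J - j1 + j2 + 1)
                * Gamma (j1 + j2 - J + 1) / Gamma (j1 + j2 + J + 2))
        * sqrt (Gamma (J + M + 1) * Gamma (J - M + 1)
                * Gamma (j1 - m1 + 1) * Gamma (j1 + m1 + 1)
                * Gamma (j2 - m2 + 1) * Gamma (j2 + m2 + 1))
        * (\<Sum>k\<le>nat \<lfloor>j1 + j2 - J\<rfloor>. (-1) ^ k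
             * rGamma (real k + 1) * rGamma (j1 + j2 - J - real k + 1)
             * rGamma (j1 - m1 - real k + 1) * rGamma (j2 + m2 - real k + 1)
             * rGamma (J - j2 + m1 + real k + 1) * rGamma (J - j1 - m2 + real k + 1))
      else 0)"

definition racah_sum :: "real \<Rightarrow> real \<Rightarrow> real \<Rightarrow> real \<Rightarrow> real \<Rightarrow> real" where
  "racah_sum c a b d e =
     (\<Sum>k\<le>nat \<lfloor>c\<rfloor>. (-1) ^ k
        * rGamma (real k + 1) * rGamma (c - real k + 1)
        * rGamma (a - real k + 1) * rGamma (b - real k + 1)
        * rGamma (d + real k + 1) * rGamma (e + real k + 1))"

lemma racah_sum_swap: "racah_sum c a b d e = racah_sum c b a e d"
  unfolding racah_sum_def by (intro sum.cong refl) (simp add: mult_ac)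

lemma sum_alternating_telescope:
  fixes u :: "nat \<Rightarrow> real"
  shows "(\<Sum>k\<le>n. (-1) ^ k * (u k + u (Suc k))) = u 0 + (-1) ^ n * u (Suc n)"
  by (induction n) (simp_all add: algebra_simps)

lemma racah_sum_contiguous:
  assumes "c \<in> \<nat>"
  shows "(d + b) * racah_sum c a b d e
           = (a + 1) * racah_sum c (a + 1) b (d - 1) e
             + (c + e + 1) * racah_sum c a (b - 1) d (e + 1)"
proof -
  obtain n where n: "c = real n" using assms by (auto elim: Nats_cases)
  have rg: "rGamma x = x * rGamma (x + 1)" for x :: real by (rule rGamma_plus1[symmetric])
  define u where "u k = rGamma (real k) * rGamma (c - real k + 1) * rGamma (a - real k + 2)
      * rGamma (b - real k + 1) * rGamma (d + real k) * rGamma (e + real k + 1)" for k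
  have step: "(a + 1) * ((-1) ^ k
        * rGamma (real k + 1) * rGamma (c - real k + 1)
        * rGamma (a + 1 - real k + 1) * rGamma (b - real k + 1)
        * rGamma (d - 1 + real k + 1) * rGamma (e + real k + 1))
      + (c + e + 1) * ((-1) ^ k
        * rGamma (real k + 1) * rGamma (c - real k + 1)
        * rGamma (a - real k + 1) * rGamma (b - 1 - real k + 1)
        * rGamma (d + real k + 1) * rGamma (e + 1 + real k + 1))
      - (d + b) * ((-1) ^ k
        * rGamma (real k + 1) * rGamma (c - real k + 1)
        * rGamma (a - real k + 1) * rGamma (b - real k + 1)
        * rGamma (d + real k + 1) * rGamma (e + real k + 1))
      = (-1) ^ k * (u k + u (Suc k))" for k
  proof -
    define K where "K = real k"
    define s where "s = (-1 :: real) ^ k"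
    define gk where "gk = rGamma (K + 1)"
    define gc where "gc = rGamma (c - K + 1)"
    define ga where "ga = rGamma (a - K + 2)"
    define gb where "gb = rGamma (b - K + 1)"
    define gd where "gd = rGamma (d + K + 1)"
    define ge where "ge = rGamma (e + K + 2)"
    have *: "rGamma K = K * gk" "rGamma (c - K) = (c - K) * gc"
      "rGamma (a - K + 1) = (a - K + 1) * ga" "rGamma (b - K) = (b - K) * gb"
      "rGamma (d + K) = (d + K) * gd" "rGamma (e + K + 1) = (e + K + 1) * ge"
      using rg[of K] rg[of "c - K"] rg[of "a - K + 1"] rg[of "b - K"] rg[of "d + K"]
        rg[of "e + K + 1"]
      by (simp_all add: gk_def gc_def ga_def gb_def gd_def ge_def add.assoc)
    have arg: "a + 1 - K + 1 = a - K + 2" "d - 1 + K + 1 = d + K" "b - 1 - K + 1 = b - K"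
      "e + 1 + K + 1 = e + K + 2" "c - (K + 1) + 1 = c - K" "a - (K + 1) + 2 = a - K + 1"
      "b - (K + 1) + 1 = b - K" "d + (K + 1) = d + K + 1" "e + (K + 1) + 1 = e + K + 2"
      by simp_all
    have uk: "u k = K * gk * gc * ga * gb * ((d + K) * gd) * ((e + K + 1) * ge)"
      unfolding u_def K_def[symmetric] * by (simp add: gc_def ga_def gb_def)
    have "real (Suc k) = K + 1" by (simp add: K_def)
    then have us: "u (Suc k) = gk * ((c - K) * gc) * ((a - K + 1) * ga) * ((b - K) * gb) * gd * ge"
      unfolding u_def by (simp only: arg *) (simp add: gk_def gd_def ge_def)
    show ?thesis
      unfolding K_def[symmetric] s_def[symmetric] arg uk us *
      unfolding gk_def[symmetric] gc_def[symmetric] ga_def[symmetric] gb_def[symmetric]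
        gd_def[symmetric] ge_def[symmetric]
      by algebra
  qed
  have "(a + 1) * racah_sum c (a + 1) b (d - 1) e
             + (c + e + 1) * racah_sum c a (b - 1) d (e + 1)
             - (d + b) * racah_sum c a b d e = (\<Sum>k\<le>n. (-1) ^ k * (u k + u (Suc k)))"
    unfolding racah_sum_def n floor_of_nat nat_int
    unfolding sum_distrib_left sum.distrib[symmetric] sum_subtractf[symmetric]
    using step[unfolded n] by (intro sum.cong refl)
  also have "\<dots> = 0"
    unfolding sum_alternating_telescope by (simp add: u_def n rGamma_eq_zero_iff)
  finally show ?thesis by simp
qed

lemma rGamma_eq_0_or:
  fixes p q :: real
  assumes "p \<in> \<int>" "p + q = -1"
  shows "rGamma (p + 1) = 0 \<or> rGamma (q + 1) = 0"
proof -
  obtain i where i: "p = of_int i" using assms(1) by (auto elim: Ints_cases)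
  have q: "q + 1 = of_int (- i)" using assms i by simp
  have p: "p + 1 = of_int (i + 1)" using i by simp
  show ?thesis unfolding p q rGamma_eq_zero_iff of_int_in_nonpos_Ints_iff by linarith
qed

lemma racah_sum_eq_0:
  assumes "a + e = -1 \<and> a \<in> \<int> \<or> c + d = -1 \<and> c \<in> \<int> \<or> b = -1"
  shows "racah_sum c a b d e = 0"
  unfolding racah_sum_def
proof (intro sum.neutral ballI)
  fix k
  show "(-1) ^ k
        * rGamma (real k + 1) * rGamma (c - real k + 1)
        * rGamma (a - real k + 1) * rGamma (b - real k + 1)
        * rGamma (d + real k + 1) * rGamma (e + real k + 1) = 0"
    using assms rGamma_eq_0_or[of "a - real k" "e + real k"]
      rGamma_eq_0_or[of "c - real k" "d + real k"] rGamma_eq_0_or[of "real k" "b - real k"]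
    by auto
qed

lemma sqrt_Gamma_shift:
  assumes "x \<in> \<nat>" "y \<in> \<nat>" "x \<noteq> 0"
  shows "sqrt (x * (y + 1)) * sqrt (Gamma (y + 2) * Gamma x)
           = (y + 1) * sqrt (Gamma (y + 1) * Gamma (x + 1))"
proof -
  have pos: "x > 0" "y \<ge> 0" using assms Nats_subset_Ints by (auto elim!: Nats_cases)
  have "x \<notin> \<int>\<^sub>\<le>\<^sub>0" "y + 1 \<notin> \<int>\<^sub>\<le>\<^sub>0" using pos by (auto elim!: nonpos_Ints_cases)
  then have G: "Gamma (x + 1) = x * Gamma x" "Gamma (y + 2) = (y + 1) * Gamma (y + 1)"
    using Gamma_plus1[of x] Gamma_plus1[of "y + 1"] by (simp_all add: add.assoc)
  have "sqrt (x * (y + 1)) * sqrt (Gamma (y + 2) * Gamma x)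
      = sqrt ((y + 1)\<^sup>2 * (Gamma (y + 1) * Gamma (x + 1)))"
    unfolding real_sqrt_mult[symmetric] G by (simp add: power2_eq_square mult_ac)
  also have "\<dots> = (y + 1) * sqrt (Gamma (y + 1) * Gamma (x + 1))"
    using pos by (simp add: real_sqrt_mult)
  finally show ?thesis .
qed


lemma clebsch_gordan_racah_sum:
  assumes "cg_admissible j1 m1 j2 m2 J M"
  shows "clebsch_gordan j1 m1 j2 m2 J M =
        sqrt ((2 * J + 1) * Gamma (J + j1 - j2 + 1) * Gamma (J - j1 + j2 + 1)
                * Gamma (j1 + j2 - J + 1) / Gamma (j1 + j2 + J + 2))
        * sqrt (Gamma (J + M + 1) * Gamma (J - M + 1))
        * sqrt (Gamma (j1 - m1 + 1) * Gamma (j1 + m1 + 1))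
        * sqrt (Gamma (j2 - m2 + 1) * Gamma (j2 + m2 + 1))
        * racah_sum (j1 + j2 - J) (j1 - m1) (j2 + m2) (J - j2 + m1) (J - j1 - m2)"
  using assms unfolding clebsch_gordan_def racah_sum_def
  by (simp add: real_sqrt_mult mult.assoc)

lemma Nats_minus_1: "x \<in> \<nat> \<Longrightarrow> x \<noteq> 0 \<Longrightarrow> x - 1 \<in> \<nat>" for x :: real
proof (elim Nats_cases)
  fix n assume "x = real n" "x \<noteq> 0"
  then have "x - 1 = real (n - 1)" by (cases n) auto
  then show ?thesis by simp
qed

lemma Nats_plus_1: "x \<in> \<nat> \<Longrightarrow> x + 1 \<in> \<nat>" for x :: real
  by (rule Nats_add) simp_all

lemma clebsch_gordan_raise:
  assumes "{j1 + m1, j1 - m1, j2 + m2, j2 - m2, J + M, J - M} \<subseteq> \<nat>"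
    and "{j1 + j2 - J, J + j1 - j2, J - j1 + j2} \<subseteq> \<nat>"
    and M: "m1 + m2 = M + 1"
  shows "sqrt ((J - M) * (J + M + 1)) * clebsch_gordan j1 m1 j2 m2 J (M + 1)
       = sqrt ((j1 + m1) * (j1 - m1 + 1)) * clebsch_gordan j1 (m1 - 1) j2 m2 J M
         + sqrt ((j2 + m2) * (j2 - m2 + 1)) * clebsch_gordan j1 m1 j2 (m2 - 1) J M"
proof -
  define N where "N = sqrt ((2 * J + 1) * Gamma (J + j1 - j2 + 1) * Gamma (J - j1 + j2 + 1)
                * Gamma (j1 + j2 - J + 1) / Gamma (j1 + j2 + J + 2))"
  define PJ where "PJ = sqrt (Gamma (J + M + 1) * Gamma (J - M + 1))"
  define P1 where "P1 = sqrt (Gamma (j1 - m1 + 1) * Gamma (j1 + m1 + 1))"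
  define P2 where "P2 = sqrt (Gamma (j2 - m2 + 1) * Gamma (j2 + m2 + 1))"
  define c a b d e where "c = j1 + j2 - J" and "a = j1 - m1" and "b = j2 + m2"
    and "d = J - j2 + m1" and "e = J - j1 - m2"
  have nats: "c \<in> \<nat>" "a \<in> \<nat>" "b \<in> \<nat>" "j1 + m1 \<in> \<nat>" "j2 - m2 \<in> \<nat>" "J + M \<in> \<nat>" "J - M \<in> \<nat>"
    using assms by (simp_all add: c_def a_def b_def)
  have ints: "c \<in> \<int>" "a \<in> \<int>" using nats Nats_subset_Ints by blast+
  have J: "sqrt ((J - M) * (J + M + 1)) * clebsch_gordan j1 m1 j2 m2 J (M + 1)
      = N * PJ * P1 * P2 * ((d + b) * racah_sum c a b d e)"
  proof (cases "J - M = 0")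
    case True
    then have "racah_sum c a b d e = 0"
      using M ints by (intro racah_sum_eq_0) (simp add: a_def e_def)
    then show ?thesis using True by simp
  next
    case False
    have adm: "cg_admissible j1 m1 j2 m2 J (M + 1)"
      using assms Nats_minus_1[OF nats(7) False] Nats_plus_1[OF nats(6)]
      by (simp add: cg_admissible_def algebra_simps)
    have shift: "sqrt ((J - M) * (J + M + 1)) * sqrt (Gamma (J + M + 2) * Gamma (J - M))
        = (d + b) * PJ"
      using sqrt_Gamma_shift[OF nats(7,6) False] M by (simp add: PJ_def d_def b_def)
    have arg: "J + (M + 1) + 1 = J + M + 2" "J - (M + 1) + 1 = J - M" by simp_all
    have "clebsch_gordan j1 m1 j2 m2 J (M + 1)
        = N * sqrt (Gamma (J + M + 2) * Gamma (J - M)) * P1 * P2 * racah_sum c a b d e"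
      unfolding clebsch_gordan_racah_sum[OF adm] N_def P1_def P2_def c_def a_def b_def d_def e_def arg ..
    then have "sqrt ((J - M) * (J + M + 1)) * clebsch_gordan j1 m1 j2 m2 J (M + 1)
        = N * (sqrt ((J - M) * (J + M + 1)) * sqrt (Gamma (J + M + 2) * Gamma (J - M)))
            * P1 * P2 * racah_sum c a b d e"
      by (simp only: mult_ac)
    then show ?thesis unfolding shift by (simp only: mult_ac)
  qed
  have 1: "sqrt ((j1 + m1) * (j1 - m1 + 1)) * clebsch_gordan j1 (m1 - 1) j2 m2 J M
      = N * PJ * P1 * P2 * ((a + 1) * racah_sum c (a + 1) b (d - 1) e)"
  proof (cases "j1 + m1 = 0")
    case True
    then have "racah_sum c (a + 1) b (d - 1) e = 0"
      using ints by (intro racah_sum_eq_0) (simp add: c_def d_def)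
    then show ?thesis using True by simp
  next
    case False
    have adm: "cg_admissible j1 (m1 - 1) j2 m2 J M"
      using assms Nats_minus_1[OF nats(4) False] Nats_plus_1[OF nats(2)]
      by (simp add: cg_admissible_def a_def algebra_simps)
    have shift: "sqrt ((j1 + m1) * (j1 - m1 + 1)) * sqrt (Gamma (j1 - m1 + 2) * Gamma (j1 + m1))
        = (a + 1) * P1"
      using sqrt_Gamma_shift[OF nats(4,2) False] by (simp add: P1_def a_def)
    have arg: "j1 - (m1 - 1) + 1 = j1 - m1 + 2" "j1 + (m1 - 1) + 1 = j1 + m1"
      "j1 - (m1 - 1) = j1 - m1 + 1" "J - j2 + (m1 - 1) = J - j2 + m1 - 1"
      by simp_all
    have "clebsch_gordan j1 (m1 - 1) j2 m2 J M
        = N * PJ * sqrt (Gamma (j1 - m1 + 2) * Gamma (j1 + m1)) * P2 * racah_sum c (a + 1) b (d - 1) e"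
      unfolding clebsch_gordan_racah_sum[OF adm] arg(1,2)
      unfolding N_def PJ_def P2_def c_def a_def b_def d_def e_def arg(3,4) ..
    then have "sqrt ((j1 + m1) * (j1 - m1 + 1)) * clebsch_gordan j1 (m1 - 1) j2 m2 J M
        = N * PJ * (sqrt ((j1 + m1) * (j1 - m1 + 1)) * sqrt (Gamma (j1 - m1 + 2) * Gamma (j1 + m1)))
            * P2 * racah_sum c (a + 1) b (d - 1) e"
      by (simp only: mult_ac)
    then show ?thesis unfolding shift by (simp only: mult_ac)
  qed
  have 2: "sqrt ((j2 + m2) * (j2 - m2 + 1)) * clebsch_gordan j1 m1 j2 (m2 - 1) J M
      = N * PJ * P1 * P2 * ((c + e + 1) * racah_sum c a (b - 1) d (e + 1))"
  proof (cases "b = 0")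
    case True
    then have "racah_sum c a (b - 1) d (e + 1) = 0"
      by (intro racah_sum_eq_0) simp
    then show ?thesis using True by (simp add: b_def)
  next
    case False
    have adm: "cg_admissible j1 m1 j2 (m2 - 1) J M"
      using assms Nats_minus_1[OF nats(3) False] Nats_plus_1[OF nats(5)]
      by (simp add: cg_admissible_def b_def algebra_simps)
    have shift: "sqrt ((j2 + m2) * (j2 - m2 + 1)) * sqrt (Gamma (j2 - m2 + 2) * Gamma (j2 + m2))
        = (c + e + 1) * P2"
      using sqrt_Gamma_shift[OF nats(3,5) False] by (simp add: P2_def b_def c_def e_def)
    have arg: "j2 - (m2 - 1) + 1 = j2 - m2 + 2" "j2 + (m2 - 1) + 1 = j2 + m2"
      "j2 + (m2 - 1) = j2 + m2 - 1" "J - j1 - (m2 - 1) = J - j1 - m2 + 1"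
      by simp_all
    have "clebsch_gordan j1 m1 j2 (m2 - 1) J M
        = N * PJ * P1 * sqrt (Gamma (j2 - m2 + 2) * Gamma (j2 + m2)) * racah_sum c a (b - 1) d (e + 1)"
      unfolding clebsch_gordan_racah_sum[OF adm] arg(1,2)
      unfolding N_def PJ_def P1_def c_def a_def b_def d_def e_def arg(3,4) ..
    then have "sqrt ((j2 + m2) * (j2 - m2 + 1)) * clebsch_gordan j1 m1 j2 (m2 - 1) J M
        = N * PJ * P1 * (sqrt ((j2 + m2) * (j2 - m2 + 1)) * sqrt (Gamma (j2 - m2 + 2) * Gamma (j2 + m2)))
            * racah_sum c a (b - 1) d (e + 1)"
      by (simp only: mult_ac)
    then show ?thesis unfolding shift by (simp only: mult_ac)
  qed
  show ?thesis
    unfolding J 1 2 racah_sum_contiguous[OF nats(1)] by (simp add: algebra_simps)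
qed

lemma racah_sum_reverse:
  assumes "c \<in> \<nat>"
  shows "racah_sum c (c + d) (c + e) (a - c) (b - c) = (-1) ^ nat \<lfloor>c\<rfloor> * racah_sum c a b d e"
proof -
  obtain n where n: "c = real n" using assms by (auto elim: Nats_cases)
  show ?thesis
    unfolding racah_sum_def n floor_of_nat nat_int sum_distrib_left
  proof (intro sum.reindex_bij_witness[of _ "\<lambda>k. n - k" "\<lambda>k. n - k"], goal_cases)
    case (5 k)
    then have "k \<le> n" by simp
    then have "(-1 :: real) ^ n * (-1) ^ (n - k) = (-1) ^ k"
      by (metis (no_types, lifting) diff_diff_cancel diff_le_self le_add_diff_inverse
          minus_one_power_iff power_add even_diff_nat mult.commute mult_1 mult_minus_left
          mult_minus_right minus_minus)
    then show ?case
      using \<open>k \<le> n\<close> unfolding mult.assoc[symmetric] by (simp add: of_nat_diff algebra_simps)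
  qed auto
qed

lemma clebsch_gordan_minus:
  assumes "j1 + j2 - J \<in> \<nat>"
  shows "clebsch_gordan j1 (- m1) j2 (- m2) J (- M)
       = (-1) ^ nat \<lfloor>j1 + j2 - J\<rfloor> * clebsch_gordan j1 m1 j2 m2 J M"
proof (cases "cg_admissible j1 m1 j2 m2 J M")
  case True
  then have "cg_admissible j1 (- m1) j2 (- m2) J (- M)"
    by (auto simp: cg_admissible_def)
  note adm = this
  have arg: "j1 - - m1 = j1 + m1" "j1 + - m1 = j1 - m1" "j2 - - m2 = j2 + m2" "j2 + - m2 = j2 - m2"
    "J + - M = J - M" "J - - M = J + M"
    "J - j2 - m1 = j1 - m1 - (j1 + j2 - J)" "J - j1 + m2 = j2 + m2 - (j1 + j2 - J)"
    "J - j2 + - m1 = j1 - m1 - (j1 + j2 - J)" "J - j1 - - m2 = j2 + m2 - (j1 + j2 - J)"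
    by simp_all
  have arg2: "j1 + m1 = j1 + j2 - J + (J - j2 + m1)" "j2 - m2 = j1 + j2 - J + (J - j1 - m2)"
    by simp_all
  have rev: "racah_sum (j1 + j2 - J) (j1 + m1) (j2 - m2) (j1 - m1 - (j1 + j2 - J)) (j2 + m2 - (j1 + j2 - J))
      = (-1) ^ nat \<lfloor>j1 + j2 - J\<rfloor> * racah_sum (j1 + j2 - J) (j1 - m1) (j2 + m2) (J - j2 + m1) (J - j1 - m2)"
    unfolding arg2 by (rule racah_sum_reverse[OF assms])
  show ?thesis
    unfolding clebsch_gordan_racah_sum[OF True] clebsch_gordan_racah_sum[OF adm] arg rev
    by (simp only: mult_ac)
next
  case False
  then have "\<not> cg_admissible j1 (- m1) j2 (- m2) J (- M)"
    by (auto simp: cg_admissible_def)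
  with False show ?thesis by (simp add: clebsch_gordan_def)
qed

lemma clebsch_gordan_lower:
  assumes "{j1 + m1, j1 - m1, j2 + m2, j2 - m2, J + M, J - M} \<subseteq> \<nat>"
    and "{j1 + j2 - J, J + j1 - j2, J - j1 + j2} \<subseteq> \<nat>"
    and "m1 + m2 = M - 1"
  shows "sqrt ((J + M) * (J - M + 1)) * clebsch_gordan j1 m1 j2 m2 J (M - 1)
       = sqrt ((j1 - m1) * (j1 + m1 + 1)) * clebsch_gordan j1 (m1 + 1) j2 m2 J M
         + sqrt ((j2 - m2) * (j2 + m2 + 1)) * clebsch_gordan j1 m1 j2 (m2 + 1) J M"
proof -
  have c: "j1 + j2 - J \<in> \<nat>" using assms by simp
  let ?s = "(-1 :: real) ^ nat \<lfloor>j1 + j2 - J\<rfloor>"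
  have eqs: "clebsch_gordan j1 (- m1) j2 (- m2) J (- M + 1) = ?s * clebsch_gordan j1 m1 j2 m2 J (M - 1)"
    "clebsch_gordan j1 (- m1 - 1) j2 (- m2) J (- M) = ?s * clebsch_gordan j1 (m1 + 1) j2 m2 J M"
    "clebsch_gordan j1 (- m1) j2 (- m2 - 1) J (- M) = ?s * clebsch_gordan j1 m1 j2 (m2 + 1) J M"
    using clebsch_gordan_minus[OF c, of m1 m2 "M - 1"] clebsch_gordan_minus[OF c, of "m1 + 1" m2 M]
      clebsch_gordan_minus[OF c, of m1 "m2 + 1" M] by simp_all
  have "?s * (sqrt ((J + M) * (J - M + 1)) * clebsch_gordan j1 m1 j2 m2 J (M - 1))
      = ?s * (sqrt ((j1 - m1) * (j1 + m1 + 1)) * clebsch_gordan j1 (m1 + 1) j2 m2 J M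
         + sqrt ((j2 - m2) * (j2 + m2 + 1)) * clebsch_gordan j1 m1 j2 (m2 + 1) J M)"
    using clebsch_gordan_raise[of j1 "- m1" j2 "- m2" J "- M"] assms
    unfolding eqs by (simp add: algebra_simps)
  then show ?thesis by simp
qed

lemma choose_convolution:
  "(\<Sum>a\<le>c. ((q + a) choose a) * ((p + c - a) choose (c - a))) = (p + q + 1 + c) choose c"
proof -
  have neg: "real ((r + k) choose k) = (-1) ^ k * ((- (real r + 1)) gchoose k)" for r k
    unfolding gbinomial_minus by (simp add: binomial_gbinomial add_ac flip: mult.assoc power_add)
  have "real (\<Sum>a\<le>c. ((q + a) choose a) * ((p + c - a) choose (c - a)))
      = (\<Sum>a\<le>c. (-1) ^ c * (((- (real q + 1)) gchoose a) * ((- (real p + 1)) gchoose (c - a))))"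
    unfolding of_nat_sum
  proof (intro sum.cong refl, goal_cases)
    case (1 a)
    then have "p + c - a = p + (c - a)" "(-1 :: real) ^ c = (-1) ^ a * (-1) ^ (c - a)"
      by (simp_all flip: power_add)
    then show ?case by (simp only: of_nat_mult neg) simp
  qed
  also have "\<dots> = (-1) ^ c * ((- (real (p + q + 1) + 1)) gchoose c)"
    unfolding sum_distrib_left[symmetric] gbinomial_Vandermonde[folded atMost_atLeast0]
    by (intro arg_cong[where f = "\<lambda>x. (-1) ^ c * (x gchoose c)"]) simp
  also have "\<dots> = real ((p + q + 1 + c) choose c)" by (rule neg[symmetric])
  finally show ?thesis by (simp only: of_nat_eq_iff)
qed

lemma clebsch_gordan_highest_weight:
  fixes p q c a :: nat
  assumes "a \<le> c"
  defines "j1 \<equiv> real (p + c) / 2" and "j2 \<equiv> real (q + c) / 2" and "J \<equiv> real (p + q) / 2"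
  shows "clebsch_gordan j1 (j1 - real a) j2 (J - j1 + real a) J J
       = (-1) ^ a * sqrt (real ((q + a) choose a) * real ((p + c - a) choose (c - a))
                            / real ((p + q + 1 + c) choose c))"
proof -
  obtain b where b: "c = a + b" using assms(1) by (auto simp: le_iff_add)
  have G: "Gamma (real n + 1) = fact n" "rGamma (real n + 1) = inverse (fact n)" for n
    using Gamma_fact[of n, where 'a = real] by (simp_all add: rGamma_inverse_Gamma add.commute)
  have G0: "rGamma (- real n) = 0" for n by (simp add: rGamma_eq_zero_iff)
  have arg: "J + J = real (p + q)" "J - J = real 0"
    "j1 + (j1 - real a) = real (p + b)" "j1 - (j1 - real a) = real a"
    "j2 + (J - j1 + real a) = real (q + a)" "j2 - (J - j1 + real a) = real b"
    "j1 + j2 - J = real c" "J + j1 - j2 = real p" "J - j1 + j2 = real q"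
    "J - j2 + (j1 - real a) = real p - real a" "J - j1 - (J - j1 + real a) = - real a"
    "j1 + j2 + J + 2 = real (p + q + c + 1) + 1" "2 * J + 1 = real (p + q + 1)"
    unfolding j1_def j2_def J_def b by (simp_all add: field_simps)
  have "racah_sum (real c) (real a) (real (q + a)) (real p - real a) (- real a)
      = (\<Sum>k\<le>c. if k = a then (-1) ^ a / (fact a * fact b * fact q * fact p) else 0)"
    unfolding racah_sum_def floor_of_nat nat_int
  proof (intro sum.cong refl, goal_cases)
    case (1 k)
    consider "k < a" | "k = a" | "k > a" by linarith
    then show ?case
    proof cases
      assume "k < a"
      then have "- real a + real k + 1 = - real (a - k - 1)" by simp
      then show ?thesis using \<open>k < a\<close> by (simp only: G0) simp
    next
      assume "k > a"
      then have "real a - real k + 1 = - real (k - a - 1)" by simp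
      then show ?thesis using \<open>k > a\<close> by (simp only: G0) simp
    next
      assume "k = a"
      then show ?thesis using G(2)[of a] G(2)[of b] G(2)[of q] G(2)[of p] G(2)[of 0]
        by (simp add: b field_simps)
    qed
  qed
  also have "\<dots> = (-1) ^ a / (fact a * fact b * fact q * fact p)" using assms(1) by simp
  finally have S: "racah_sum (real c) (real a) (real (q + a)) (real p - real a) (- real a)
      = (-1) ^ a / (fact a * fact b * fact q * fact p)" .
  have adm: "cg_admissible j1 (j1 - real a) j2 (J - j1 + real a) J J"
    unfolding cg_admissible_def arg by (simp only: insert_subset of_nat_in_Nats) simp
  define F where "F = (fact a * fact b * fact q * fact p :: real)"
  have "F > 0" by (simp add: F_def)
  have choose: "real ((q + a) choose a) = fact (q + a) / (fact q * fact a)"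
    "real ((p + c - a) choose (c - a)) = fact (p + b) / (fact p * fact b)"
    "real ((p + q + 1 + c) choose c) = fact (p + q + c + 1) / (fact (p + q + 1) * fact c)"
    using binomial_fact[of a "q + a", where 'a = real] binomial_fact[of b "p + b", where 'a = real]
      binomial_fact[of c "p + q + 1 + c", where 'a = real]
    by (simp_all add: b ac_simps)
  have "clebsch_gordan j1 (j1 - real a) j2 (J - j1 + real a) J J
      = sqrt (real (p + q + 1) * fact p * fact q * fact c / fact (p + q + c + 1))
        * sqrt (fact (p + q) * fact 0) * sqrt (fact a * fact (p + b)) * sqrt (fact b * fact (q + a))
        * ((-1) ^ a / F)"
    unfolding clebsch_gordan_racah_sum[OF adm] arg S G F_def ..
  also have "\<dots> = (-1) ^ a * (sqrt (real (p + q + 1) * fact p * fact q * fact c / fact (p + q + c + 1)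
        * (fact (p + q) * fact 0) * (fact a * fact (p + b)) * (fact b * fact (q + a))) / sqrt (F\<^sup>2))"
    using \<open>F > 0\<close> unfolding real_sqrt_mult[symmetric] by simp
  also have "\<dots> = (-1) ^ a * sqrt (fact (q + a) / (fact q * fact a) * (fact (p + b) / (fact p * fact b))
        / (fact (p + q + c + 1) / (fact (p + q + 1) * fact c)))"
  proof -
    define D where "D = (fact (p + q + c + 1) :: real)"
    have "D > 0" by (simp add: D_def)
    moreover have "fact (p + q + 1) = real (p + q + 1) * fact (p + q)" by (simp add: mult.commute)
    ultimately show ?thesis
      unfolding real_sqrt_divide[symmetric] F_def D_def[symmetric]
      by (simp add: power2_eq_square mult_ac)
  qed
  finally show ?thesis unfolding choose .
qed

lemma coupled_spins:
  assumes "{j1 + j2 - J, J + j1 - j2, J - j1 + j2} \<subseteq> \<nat>"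
  obtains p q c where "j1 = real (p + c) / 2" "j2 = real (q + c) / 2" "J = real (p + q) / 2"
proof -
  obtain c p q where "j1 + j2 - J = real c" "J + j1 - j2 = real p" "J - j1 + j2 = real q"
    using assms by (auto elim!: Nats_cases)
  then show ?thesis by (intro that[of p c q]) (simp_all add: field_simps)
qed

lemma clebsch_gordan_phase:
  assumes "{j1 + j2 - J, J + j1 - j2, J - j1 + j2} \<subseteq> \<nat>"
  shows "clebsch_gordan j1 j1 j2 (J - j1) J J > 0"
proof -
  obtain p q c where "j1 = real (p + c) / 2" "j2 = real (q + c) / 2" "J = real (p + q) / 2"
    using coupled_spins[OF assms] .
  then show ?thesis
    using clebsch_gordan_highest_weight[of 0 c p q]
    by (simp only: of_nat_0 diff_zero add_0_right) simp
qed

lemma clebsch_gordan_normalized: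
  assumes "{j1 + j2 - J, J + j1 - j2, J - j1 + j2} \<subseteq> \<nat>"
  shows "(\<Sum>a\<le>nat \<lfloor>2 * j1\<rfloor>. (clebsch_gordan j1 (j1 - real a) j2 (J - j1 + real a) J J)\<^sup>2) = 1"
proof -
  obtain p q c where *: "j1 = real (p + c) / 2" "j2 = real (q + c) / 2" "J = real (p + q) / 2"
    using coupled_spins[OF assms] .
  have n: "nat \<lfloor>2 * j1\<rfloor> = p + c" by (simp add: * flip: of_nat_add)
  have "clebsch_gordan j1 (j1 - real a) j2 (J - j1 + real a) J J = 0" if "a > c" for a
  proof -
    have "j2 - (J - j1 + real a) = real c - real a" by (simp add: * field_simps)
    moreover have "real c - real a \<notin> \<nat>" using that by (auto elim!: Nats_cases)
    ultimately have "\<not> cg_admissible j1 (j1 - real a) j2 (J - j1 + real a) J J"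
      by (simp only: cg_admissible_def insert_subset) simp
    then show ?thesis unfolding clebsch_gordan_def by (rule if_not_P)
  qed
  then have "(\<Sum>a\<le>p + c. (clebsch_gordan j1 (j1 - real a) j2 (J - j1 + real a) J J)\<^sup>2)
      = (\<Sum>a\<le>c. (clebsch_gordan j1 (j1 - real a) j2 (J - j1 + real a) J J)\<^sup>2)"
    by (intro sum.mono_neutral_right) auto
  also have "\<dots> = (\<Sum>a\<le>c. real (((q + a) choose a) * ((p + c - a) choose (c - a)))
                            / real ((p + q + 1 + c) choose c))"
    unfolding * by (intro sum.cong refl, subst clebsch_gordan_highest_weight)
      (simp_all add: power_mult_distrib flip: power_mult)
  also have "\<dots> = 1"
    unfolding sum_divide_distrib[symmetric] of_nat_sum[symmetric] choose_convolution by simp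
  finally show ?thesis unfolding n .
qed

lemma clebsch_gordan_selection: "m1 + m2 \<noteq> M \<Longrightarrow> clebsch_gordan j1 m1 j2 m2 J M = 0"
  by (simp add: clebsch_gordan_def cg_admissible_def)


section \<open>Wigner kernel and the polytope of absolutely Wigner bounded spectra\<close>

definition wigner_eigenvalue :: "real \<Rightarrow> real \<Rightarrow> real" where
  "wigner_eigenvalue j m =
     (\<Sum>L\<le>nat \<lfloor>2 * j\<rfloor>. (2 * real L + 1) / (2 * j + 1) * clebsch_gordan j m (real L) 0 j m)"

text \<open>
  Eigenvalues and spectra are indexed by \<open>{..2j}\<close>. Points of the Euclidean space of
  dimension \<open>2j + 1\<close> are the extensional functions on this index set.
\<close>

definition spin_index :: "real \<Rightarrow> nat set" where
  "spin_index j = {..nat \<lfloor>2 * j\<rfloor>}"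

definition kernel_eigenvalue :: "real \<Rightarrow> nat \<Rightarrow> real" where
  "kernel_eigenvalue j i = wigner_eigenvalue j (- j + real i)"

definition trace_one_hyperplane :: "real \<Rightarrow> (nat \<Rightarrow> real) set" where
  "trace_one_hyperplane j = {l \<in> spin_index j \<rightarrow>\<^sub>E UNIV. (\<Sum>i\<in>spin_index j. l i) = 1}"

definition state_simplex :: "real \<Rightarrow> (nat \<Rightarrow> real) set" where
  "state_simplex j = {l \<in> trace_one_hyperplane j. \<forall>i\<in>spin_index j. l i \<ge> 0}"

definition awb_polytope :: "real \<Rightarrow> real \<Rightarrow> (nat \<Rightarrow> real) set" where
  "awb_polytope j Wmin =
     {l \<in> trace_one_hyperplane j.
        \<forall>\<pi>. \<pi> permutes spin_index j \<longrightarrow>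
          (\<Sum>i\<in>spin_index j. l i * kernel_eigenvalue j (\<pi> i)) \<ge> Wmin}"

definition mixed_spectrum :: "real \<Rightarrow> nat \<Rightarrow> real" where
  "mixed_spectrum j = (\<lambda>i\<in>spin_index j. 1 / (2 * j + 1))"

definition spectral_ball :: "real \<Rightarrow> real \<Rightarrow> (nat \<Rightarrow> real) set" where
  "spectral_ball j r =
     {l \<in> trace_one_hyperplane j. L2_set (\<lambda>i. l i - mixed_spectrum j i) (spin_index j) \<le> r}"

definition awb_inradius :: "real \<Rightarrow> real \<Rightarrow> real" where
  "awb_inradius j Wmin = (GREATEST r. r \<ge> 0 \<and> spectral_ball j r \<subseteq> awb_polytope j Wmin)"

end

theory Submission
  imports Defs
begin

text \<open>
  The facets of the polytope are the hyperplanes orthogonal to the permuted kernel spectra, so by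
  Cauchy-Schwarz its inradius is \<open>(1/(2j+1) - Wmin) / \<sigma>\<close>, where \<open>\<sigma>\<close> is the Euclidean distance of
  \<open>(\<Delta>\<^sub>0, \<dots>, \<Delta>\<^sub>2\<^sub>j)\<close> from the mixed spectrum. What remains are the moments
  \<open>\<Sum>\<Delta>\<^sub>i = 1\<close> and \<open>\<Sum>\<Delta>\<^sub>i\<^sup>2 = 2j+1\<close>, which follow from the orthogonality relation
  \<open>\<Sum>\<^sub>m C\<^sub>K(m) C\<^sub>L(m) = \<delta>\<^sub>K\<^sub>L (2j+1)/(2L+1)\<close> for \<open>C\<^sub>L(m) = \<langle>j m; L 0 | j m\<rangle>\<close>. By Racah's formula,
  \<open>C\<^sub>L(m)\<close> is, up to normalization, the discrete Legendre polynomial of degree \<open>L\<close> in \<open>x = j + m\<close>.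
  Its Rodrigues formula and summation by parts give the orthogonality and the norms.
\<close>

section \<open>Finite differences: Leibniz rule and summation by parts\<close>

definition fwd_diff :: "(nat \<Rightarrow> real) \<Rightarrow> nat \<Rightarrow> real" where
  "fwd_diff f x = f (Suc x) - f x"

text \<open>Peels off the innermost difference, for inductions that generalize over the function;
  \<open>fwd_diff_pow_Suc_apply\<close> peels off the outermost one.\<close>

lemma fwd_diff_pow_Suc: "(fwd_diff ^^ Suc m) f = (fwd_diff ^^ m) (fwd_diff f)"
  by (simp add: funpow_swap1)

lemma fwd_diff_pow_Suc_apply:
  "(fwd_diff ^^ Suc m) f x = (fwd_diff ^^ m) f (Suc x) - (fwd_diff ^^ m) f x"
  unfolding funpow.simps o_apply by (rule fwd_diff_def)

lemma fwd_diff_pow_add: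
  "(fwd_diff ^^ m) (\<lambda>x. f x + g x) = (\<lambda>x. (fwd_diff ^^ m) f x + (fwd_diff ^^ m) g x)"
  by (induction m) (auto simp: fwd_diff_def fun_eq_iff)

lemma fwd_diff_pow_scale:
  "(fwd_diff ^^ m) (\<lambda>x. c * f x) = (\<lambda>x. c * (fwd_diff ^^ m) f x)"
  by (induction m) (auto simp: fwd_diff_def fun_eq_iff algebra_simps)

lemma fwd_diff_pow_zero: "(fwd_diff ^^ m) (\<lambda>x. 0) = (\<lambda>x. 0)"
  using fwd_diff_pow_scale[of m 0 "\<lambda>x. 0"] by simp

lemma fwd_diff_pow_sum:
  assumes "finite A"
  shows "(fwd_diff ^^ m) (\<lambda>x. \<Sum>k\<in>A. f k x) = (\<lambda>x. \<Sum>k\<in>A. (fwd_diff ^^ m) (f k) x)"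
  using assms by induction (simp_all add: fwd_diff_pow_zero fwd_diff_pow_add)

lemma fwd_diff_pow_shift: "(fwd_diff ^^ m) (\<lambda>x. f (Suc x)) x = (fwd_diff ^^ m) f (Suc x)"
  by (induction m arbitrary: x) (simp_all add: fwd_diff_pow_Suc_apply del: funpow.simps(2))

text \<open>An \<open>m\<close>-th difference at \<open>x\<close> only involves the values at
  \<open>x, ..., x + m\<close>. This makes the boundary terms of summation by parts vanish.\<close>

lemma fwd_diff_pow_eq_0:
  assumes "\<And>i. i \<le> m \<Longrightarrow> f (x + i) = 0"
  shows "(fwd_diff ^^ m) f x = 0"
  using assms
proof (induction m arbitrary: x)
  case (Suc m)
  have "(fwd_diff ^^ m) f (Suc x) = 0" using Suc.prems[of "Suc _"] by (intro Suc.IH) simp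
  moreover have "(fwd_diff ^^ m) f x = 0" using Suc.prems by (intro Suc.IH) simp
  ultimately show ?case unfolding fwd_diff_pow_Suc_apply by simp
qed (use assms[of 0] in simp)

text \<open>Leibniz rule. The shift \<open>x + k\<close> comes from the asymmetric product rule, in
  which \<open>g\<close> moves on to \<open>Suc x\<close> whenever \<open>f\<close> is differenced;
  the coefficients follow by Pascal's rule.\<close>

lemma fwd_diff_pow_mult:
  "(fwd_diff ^^ m) (\<lambda>x. f x * g x) x
     = (\<Sum>k\<le>m. real (m choose k) * ((fwd_diff ^^ k) f x * (fwd_diff ^^ (m - k)) g (x + k)))"
proof (induction m arbitrary: f g)
  case (Suc m)
  define T where "T k = (fwd_diff ^^ k) f x * (fwd_diff ^^ (Suc m - k)) g (x + k)" for k
  have "fwd_diff (\<lambda>x. f x * g x) = (\<lambda>x. fwd_diff f x * g (Suc x) + f x * fwd_diff g x)"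
    by (auto simp: fwd_diff_def fun_eq_iff algebra_simps)
  then have "(fwd_diff ^^ Suc m) (\<lambda>x. f x * g x) x
      = (\<Sum>k\<le>m. real (m choose k) * ((fwd_diff ^^ k) (fwd_diff f) x * (fwd_diff ^^ (m - k)) (\<lambda>x. g (Suc x)) (x + k)))
        + (\<Sum>k\<le>m. real (m choose k) * ((fwd_diff ^^ k) f x * (fwd_diff ^^ (m - k)) (fwd_diff g) (x + k)))"
    unfolding fwd_diff_pow_Suc by (simp only: fwd_diff_pow_add Suc.IH)
  also have "\<dots> = (\<Sum>k\<le>m. real (m choose k) * T (Suc k)) + (\<Sum>k\<le>m. real (m choose k) * T k)"
    by (intro arg_cong2[where f = "(+)"] sum.cong refl)
      (simp_all only: T_def fwd_diff_pow_shift fwd_diff_pow_Suc[symmetric] Suc_diff_le atMost_iff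
        diff_Suc_Suc add_Suc_right)
  \<comment> \<open>The added term has coefficient \<open>m choose Suc m = 0\<close>; after
    splitting off \<open>T 0\<close>, both sums run over \<open>T (Suc k)\<close>.\<close>
  also have "(\<Sum>k\<le>m. real (m choose k) * T k) = (\<Sum>k\<le>Suc m. real (m choose k) * T k)" by simp
  also have "\<dots> = T 0 + (\<Sum>k\<le>m. real (m choose Suc k) * T (Suc k))"
    by (subst sum.atMost_Suc_shift) simp
  also have "(\<Sum>k\<le>m. real (m choose k) * T (Suc k)) + \<dots> = (\<Sum>k\<le>Suc m. real (Suc m choose k) * T k)"
    by (subst sum.atMost_Suc_shift) (simp add: sum.distrib algebra_simps)
  finally show ?case unfolding T_def .
qed simp

lemma sum_fwd_diff_by_parts:
  "(\<Sum>x<N. q x * fwd_diff u x) = q N * u N - q 0 * u 0 - (\<Sum>x<N. fwd_diff q x * u (Suc x))"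
  by (induction N) (simp_all add: fwd_diff_def algebra_simps)

text \<open>Each summation by parts moves one difference from \<open>w\<close> to \<open>q\<close>
  and shifts the argument of \<open>w\<close> by one; the offset \<open>s\<close> lets the induction
  absorb this shift. The zeros of \<open>w\<close> remove the boundary terms at both ends.\<close>

lemma sum_fwd_diff_pow_by_parts:
  assumes "\<And>k. k < i \<Longrightarrow> w (s + k) = 0" "\<And>k. k < i \<Longrightarrow> w (N + s + k) = 0"
  shows "(\<Sum>x<N. q x * (fwd_diff ^^ i) w (x + s))
           = (-1) ^ i * (\<Sum>x<N. (fwd_diff ^^ i) q x * w (x + s + i))"
  using assms
proof (induction i arbitrary: q s)
  case (Suc i)
  define u where "u x = (fwd_diff ^^ i) w (x + s)" for x
  have u0: "u 0 = 0" "u N = 0"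
    unfolding u_def using Suc.prems by (auto intro!: fwd_diff_pow_eq_0)
  have "(\<Sum>x<N. q x * (fwd_diff ^^ Suc i) w (x + s)) = (\<Sum>x<N. q x * fwd_diff u x)"
    by (simp add: u_def fwd_diff_def)
  also have "\<dots> = - (\<Sum>x<N. fwd_diff q x * (fwd_diff ^^ i) w (x + Suc s))"
    unfolding sum_fwd_diff_by_parts by (simp add: u0) (simp add: u_def)
  also have "\<dots> = - ((-1) ^ i * (\<Sum>x<N. (fwd_diff ^^ i) (fwd_diff q) x * w (x + Suc s + i)))"
    using Suc.prems[of "Suc _"] by (subst Suc.IH) simp_all
  finally show ?case unfolding fwd_diff_pow_Suc by simp
qed simp

lemma fwd_diff_pow_gchoose:
  "(fwd_diff ^^ k) (\<lambda>x. real x gchoose a) = (\<lambda>x. if k \<le> a then real x gchoose (a - k) else 0)"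
proof (induction k)
  case (Suc k)
  show ?case
  proof (cases "k < a")
    case True
    then obtain b where "a = k + Suc b" using less_iff_Suc_add by auto
    then show ?thesis
      unfolding fun_eq_iff fwd_diff_pow_Suc_apply Suc
      by (simp add: add.commute[of 1] gbinomial_Suc_Suc)
  qed (auto simp: fwd_diff_pow_Suc_apply Suc fun_eq_iff simp del: funpow.simps(2))
qed simp

text \<open>Pascal's rule with decreasing upper argument, hence one sign per difference. The
  generalized binomial is a polynomial in \<open>x\<close>, so the rule persists where
  \<open>c - real x\<close> is negative; truncated subtraction would break it there.\<close>

lemma fwd_diff_pow_gchoose_reflect:
  "(fwd_diff ^^ k) (\<lambda>x. (c - real x) gchoose a)
     = (\<lambda>x. if k \<le> a then (-1) ^ k * ((c - real k - real x) gchoose (a - k)) else 0)"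
proof (induction k)
  case (Suc k)
  show ?case
  proof (cases "k < a")
    case True
    then obtain b where b: "a = k + Suc b" using less_iff_Suc_add by auto
    show ?thesis
    proof
      fix x
      define y where "y = c - real (Suc k) - real x"
      have "c - real k - real x = y + 1" "c - real k - real (Suc x) = y" by (simp_all add: y_def)
      then show "(fwd_diff ^^ Suc k) (\<lambda>x. (c - real x) gchoose a) x
        = (if Suc k \<le> a then (-1) ^ Suc k * ((c - real (Suc k) - real x) gchoose (a - Suc k)) else 0)"
        unfolding fwd_diff_pow_Suc_apply Suc y_def[symmetric]
        using gbinomial_Suc_Suc[of y b] by (simp add: b algebra_simps)
    qed
  qed (auto simp: fwd_diff_pow_Suc_apply Suc fun_eq_iff simp del: funpow.simps(2))
qed simp

section \<open>Gram polynomials: Rodrigues formula, orthogonality and norms\<close>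

text \<open>Discrete Legendre (Gram) polynomials on \<open>{0..n}\<close>, not normalized.\<close>

definition gram_poly :: "nat \<Rightarrow> nat \<Rightarrow> nat \<Rightarrow> real" where
  "gram_poly n L x =
     (\<Sum>k\<le>L. (-1) ^ k * real (L choose k) * ((real x gchoose (L - k)) * ((real n - real x) gchoose k)))"

text \<open>Discrete analogue of the function \<open>(x * (1 - x)) ^ L\<close> in the Rodrigues
  formula of the shifted Legendre polynomials: its zeros are \<open>0, ..., L - 1\<close> and
  \<open>n + 1, ..., n + L\<close>.\<close>

definition gram_weight :: "nat \<Rightarrow> nat \<Rightarrow> nat \<Rightarrow> real" where
  "gram_weight n L x = (real x gchoose L) * ((real (n + L) - real x) gchoose L)"

text \<open>The Leibniz rule matches the defining sum term by term: the shift \<open>x + k\<close>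
  and the \<open>L - k\<close> differences together turn the upper argument \<open>n + L - x\<close>
  into \<open>n - x\<close>.\<close>

lemma gram_poly_rodrigues: "gram_poly n L x = (-1) ^ L * (fwd_diff ^^ L) (gram_weight n L) x"
  unfolding gram_poly_def gram_weight_def[abs_def] fwd_diff_pow_mult sum_distrib_left
proof (intro sum.cong refl, goal_cases)
  case (1 k)
  then have "(-1 :: real) ^ L = (-1) ^ (L - k) * (-1) ^ k" by (simp flip: power_add)
  moreover have "real (n + L) - real (L - k) - real (x + k) = real n - real x" using 1 by simp
  ultimately show ?case
    using 1 unfolding fwd_diff_pow_gchoose fwd_diff_pow_gchoose_reflect by simp
qed

text \<open>A polynomial of degree \<open>K < L\<close> is annihilated. For \<open>K = L\<close> the
  two signs cancel in every summand, leaving the sum of squared binomials, which is the central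
  binomial coefficient.\<close>

lemma fwd_diff_pow_gram_poly:
  assumes "K \<le> L"
  shows "(fwd_diff ^^ L) (gram_poly n K) x = (if K = L then real ((2 * L) choose L) else 0)"
proof -
  have "(fwd_diff ^^ L) (\<lambda>x. (real x gchoose (K - k)) * ((real n - real x) gchoose k)) x
      = (if K = L then (-1) ^ k * real (L choose k) else 0)" if "k \<le> K" for k
  proof -
    \<comment> \<open>A Leibniz term survives only if \<open>i <= K - k\<close> and
      \<open>L - i <= k\<close>; with \<open>K <= L\<close> this forces \<open>K = L\<close> and
      \<open>i = L - k\<close>.\<close>
    have "(fwd_diff ^^ L) (\<lambda>x. (real x gchoose (K - k)) * ((real n - real x) gchoose k)) x
      = (\<Sum>i\<le>L. if K = L \<and> i = L - k then (-1) ^ k * real (L choose k) else 0)"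
      unfolding fwd_diff_pow_mult fwd_diff_pow_gchoose fwd_diff_pow_gchoose_reflect
      using that assms by (intro sum.cong refl) (auto simp: binomial_symmetric[symmetric])
    then show ?thesis by simp
  qed
  then have "(fwd_diff ^^ L) (gram_poly n K) x
      = (\<Sum>k\<le>K. (-1) ^ k * real (K choose k) * (if K = L then (-1) ^ k * real (L choose k) else 0))"
    unfolding gram_poly_def[abs_def] by (simp add: fwd_diff_pow_sum fwd_diff_pow_scale)
  also have "\<dots> = (if K = L then \<Sum>k\<le>L. real ((L choose k)\<^sup>2) else 0)"
    by (auto intro!: sum.cong simp: power2_eq_square simp flip: power_add mult_2)
  finally show ?thesis by (simp only: choose_square_sum flip: of_nat_sum)
qed

text \<open>A Chu-Vandermonde sum, once the binomials are reflected so that their lower indices add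
  up to \<open>n - L\<close>.\<close>

lemma sum_gram_weight:
  assumes "L \<le> n"
  shows "(\<Sum>x<Suc n. gram_weight n L (x + L)) = real ((n + L + 1) choose (2 * L + 1))"
proof -
  have "gram_weight n L (x + L) = real (((L + x) choose L) * ((n - x) choose L))" if "x \<le> n" for x
  proof -
    have "real (n + L) - real (x + L) = real (n - x)" using that by simp
    then show ?thesis
      by (simp only: gram_weight_def binomial_gbinomial of_nat_mult add.commute[of L])
  qed
  then have "(\<Sum>x<Suc n. gram_weight n L (x + L)) = real (\<Sum>x\<le>n. ((L + x) choose L) * ((n - x) choose L))"
    unfolding lessThan_Suc_atMost by simp
  \<comment> \<open>For \<open>x > n - L\<close> the second binomial is zero.\<close>
  also have "(\<Sum>x\<le>n. ((L + x) choose L) * ((n - x) choose L))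
      = (\<Sum>x\<le>n - L. ((L + x) choose L) * ((n - x) choose L))"
    by (intro sum.mono_neutral_right) auto
  also have "\<dots> = (\<Sum>x\<le>n - L. ((L + x) choose x) * ((L + (n - L) - x) choose (n - L - x)))"
    using assms by (intro sum.cong refl arg_cong2[where f = "(*)"]; subst binomial_symmetric) auto
  also have "\<dots> = (n + L + 1) choose (n - L)"
    unfolding choose_convolution using assms by (simp add: add.commute)
  also have "\<dots> = (n + L + 1) choose (2 * L + 1)"
    using assms by (subst binomial_symmetric) simp_all
  finally show ?thesis .
qed

text \<open>By Rodrigues, \<open>gram_poly n L\<close> is an \<open>L\<close>-th difference of the
  weight. Summation by parts moves all \<open>L\<close> differences onto
  \<open>gram_poly n K\<close>, which becomes zero or a constant times the sum of the
  weight.\<close>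

lemma gram_poly_orthogonal:
  assumes "K \<le> L" "L \<le> n"
  shows "(\<Sum>x\<le>n. gram_poly n K x * gram_poly n L x)
           = (if K = L then real ((2 * L) choose L) * real ((n + L + 1) choose (2 * L + 1)) else 0)"
proof -
  have 0: "gram_weight n L (0 + k) = 0" if "k < L" for k
    using that by (simp add: gram_weight_def flip: binomial_gbinomial)
  have N: "gram_weight n L (Suc n + 0 + k) = 0" if "k < L" for k
  proof -
    have "real (n + L) - real (Suc n + 0 + k) = real (L - Suc k)" using that by simp
    moreover have "real (L - Suc k) gchoose L = 0"
      using that unfolding binomial_gbinomial[symmetric] by simp
    ultimately show ?thesis by (simp only: gram_weight_def mult_zero_right)
  qed
  have "(\<Sum>x\<le>n. gram_poly n K x * gram_poly n L x)
      = (-1) ^ L * (\<Sum>x<Suc n. gram_poly n K x * (fwd_diff ^^ L) (gram_weight n L) (x + 0))"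
    unfolding gram_poly_rodrigues[of n L] sum_distrib_left lessThan_Suc_atMost
    by (simp add: mult.left_commute)
  also have "\<dots> = (-1) ^ L * ((-1) ^ L * (\<Sum>x<Suc n. (fwd_diff ^^ L) (gram_poly n K) x * gram_weight n L (x + 0 + L)))"
    by (subst sum_fwd_diff_pow_by_parts[OF 0 N]) simp_all
  also have "\<dots> = (\<Sum>x<Suc n. (fwd_diff ^^ L) (gram_poly n K) x * gram_weight n L (x + L))"
    by (simp flip: mult.assoc power_add mult_2 del: sum.lessThan_Suc)
  finally show ?thesis
    by (simp add: fwd_diff_pow_gram_poly[OF assms(1)] sum_gram_weight[OF assms(2)]
        del: sum.lessThan_Suc flip: sum_distrib_left)
qed

section \<open>Clebsch-Gordan coefficients as Gram polynomials\<close>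

text \<open>For \<open>i > x\<close> both sides vanish, the left one because \<open>rGamma\<close>
  is zero at nonpositive integers; so Racah's terms become binomials without range
  conditions.\<close>

lemma rGamma_choose: "rGamma (real i + 1) * rGamma (real x - real i + 1) * fact x = real (x choose i)"
proof (cases "i \<le> x")
  case True
  then have "real x - real i + 1 = 1 + real (x - i)" by simp
  then show ?thesis using True
    by (simp only: rGamma_inverse_Gamma add.commute[of _ 1] Gamma_fact)
      (simp add: binomial_fact divide_simps)
next
  case False
  then have *: "real x - real i + 1 = - real (i - x - 1)" by simp
  have "rGamma (real x - real i + 1) = 0" unfolding * rGamma_eq_zero_iff by simp
  then show ?thesis using False by simp
qed

text \<open>With \<open>J = j1\<close> and \<open>m2 = 0\<close>, the six reciprocal factorials of
  each Racah term pair up into \<open>L choose k\<close>, \<open>x choose (L - k)\<close> and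
  \<open>(n - x) choose k\<close>.\<close>

lemma clebsch_gordan_gram_poly:
  assumes "L \<le> n" "x \<le> n"
  defines "j \<equiv> real n / 2"
  shows "clebsch_gordan j (- j + real x) (real L) 0 j (- j + real x)
     = sqrt (real (n + 1) * fact (n - L) / fact (n + L + 1)) * fact L * gram_poly n L x"
proof -
  have G: "Gamma (real n + 1) = fact n" "rGamma (real n + 1) = inverse (fact n)" for n
    using Gamma_fact[of n, where 'a = real] by (simp_all add: rGamma_inverse_Gamma add.commute)
  have arg: "j + (- j + real x) = real x" "j - (- j + real x) = real (n - x)"
    "real L + 0 = real L" "real L - 0 = real L" "j + real L - j = real L" "j + j - real L = real (n - L)"
    "j - j + real L = real L" "j - real L + (- j + real x) = real x - real L" "j - j - 0 = real 0"
    "j + real L + j + 2 = real (n + L + 1) + 1" "2 * j + 1 = real (n + 1)"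
    using assms by (simp_all add: j_def field_simps of_nat_diff)
  have adm: "cg_admissible j (- j + real x) (real L) 0 j (- j + real x)"
    unfolding cg_admissible_def arg by (simp only: insert_subset of_nat_in_Nats) simp
  have term_eq: "(-1) ^ k * rGamma (real k + 1) * rGamma (real L - real k + 1)
        * rGamma (real (n - x) - real k + 1) * rGamma (real L - real k + 1)
        * rGamma (real x - real L + real k + 1) * rGamma (real 0 + real k + 1)
      = (-1) ^ k * real (L choose k) * ((real x gchoose (L - k)) * ((real n - real x) gchoose k))
          / (fact L * fact x * fact (n - x))" if "k \<le> L" for k
  proof -
    have arg': "real x - real L + real k + 1 = real x - real (L - k) + 1"
      "real L - real k = real (L - k)" "real 0 + real k + 1 = real k + 1"
      using that by simp_all
    have "(real n - real x) gchoose k = real ((n - x) choose k)"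
      using assms by (simp add: binomial_gbinomial of_nat_diff)
    also have "\<dots> = rGamma (real k + 1) * rGamma (real (n - x) - real k + 1) * fact (n - x)"
      by (rule rGamma_choose[symmetric])
    finally have 1: "(real n - real x) gchoose k = \<dots>" .
    have 2: "real x gchoose (L - k)
        = rGamma (real (L - k) + 1) * rGamma (real x - real (L - k) + 1) * fact x"
      unfolding binomial_gbinomial[symmetric] by (rule rGamma_choose[symmetric])
    have 3: "real (L choose k) = rGamma (real k + 1) * rGamma (real (L - k) + 1) * fact L"
      using rGamma_choose[of k L] unfolding arg' by simp
    show ?thesis unfolding 1 2 3 arg' by simp
  qed
  have S: "racah_sum (real L) (real (n - x)) (real L) (real x - real L) (real 0)
      = gram_poly n L x / (fact L * fact x * fact (n - x))"
    unfolding racah_sum_def floor_of_nat nat_int gram_poly_def sum_divide_distrib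
    by (intro sum.cong refl term_eq) simp
  have "clebsch_gordan j (- j + real x) (real L) 0 j (- j + real x)
      = sqrt (real (n + 1) * fact (n - L) * fact L * fact L / fact (n + L + 1))
        * (sqrt (fact x * fact (n - x)) * sqrt (fact (n - x) * fact x)) * sqrt (fact L * fact L)
        * (gram_poly n L x / (fact L * fact x * fact (n - x)))"
    unfolding clebsch_gordan_racah_sum[OF adm] arg S G
    by (simp only: mult_ac)
  also have "sqrt (real (n + 1) * fact (n - L) * fact L * fact L / fact (n + L + 1))
      = sqrt (real (n + 1) * fact (n - L) / fact (n + L + 1)) * fact L"
    by (simp add: real_sqrt_mult real_sqrt_divide)
  \<comment> \<open>Since \<open>J = j1\<close> and \<open>M = m1\<close> the two roots agree; their
    product cancels two of the denominators in \<open>S\<close>.\<close>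
  also have "sqrt (fact x * fact (n - x)) * sqrt (fact (n - x) * fact x) = (fact x * fact (n - x) :: real)"
    by (simp add: mult.commute)
  finally show ?thesis by (simp add: field_simps)
qed

text \<open>The varying spin \<open>L\<close> is one of the coupled spins, not the total one, so
  this is not the unitarity of a single change of basis. It is Gram orthogonality with the Racah
  prefactors squared into the norms.\<close>

lemma clebsch_gordan_orthogonal:
  assumes "K \<le> n" "L \<le> n"
  defines "j \<equiv> real n / 2"
  defines "C \<equiv> \<lambda>L x. clebsch_gordan j (- j + real x) (real L) 0 j (- j + real x)"
  shows "(\<Sum>x\<le>n. C K x * C L x) = (if K = L then real (n + 1) / real (2 * L + 1) else 0)"
proof -
  define s where "s L = sqrt (real (n + 1) * fact (n - L) / fact (n + L + 1)) * fact L" for L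
  have C: "C L x = s L * gram_poly n L x" if "L \<le> n" "x \<le> n" for L x
    using clebsch_gordan_gram_poly[OF that] by (simp add: C_def s_def j_def)
  have CC: "(\<Sum>x\<le>n. C K x * C L x) = s K * s L * (\<Sum>x\<le>n. gram_poly n K x * gram_poly n L x)"
    unfolding sum_distrib_left using assms(1,2) by (intro sum.cong) (simp_all add: C)
  show ?thesis
  proof (cases "K = L")
    case True
    define F where "F = (fact (n + L + 1) :: real)"
    have "F > 0" by (simp add: F_def)
    have "s L * s L = (sqrt (real (n + 1) * fact (n - L) / F))\<^sup>2 * (fact L)\<^sup>2"
      by (simp only: s_def F_def power2_eq_square mult_ac)
    also have "\<dots> = real (n + 1) * fact (n - L) / F * (fact L)\<^sup>2"
      using \<open>F > 0\<close> by (subst real_sqrt_pow2) simp_all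
    finally have s2: "s L * s L = real (n + 1) * fact (n - L) / F * (fact L)\<^sup>2" .
    have ch1: "real ((2 * L) choose L) = fact (2 * L) / (fact L)\<^sup>2"
      by (simp add: binomial_fact power2_eq_square)
    have "n + L + 1 - (2 * L + 1) = n - L" by simp
    then have "real ((n + L + 1) choose (2 * L + 1)) = F / (fact (2 * L + 1) * fact (n - L))"
      using assms(2) by (subst binomial_fact) (simp_all add: F_def)
    also have "fact (2 * L + 1) = real (2 * L + 1) * fact (2 * L)" by simp
    finally have ch2: "real ((n + L + 1) choose (2 * L + 1))
        = F / (real (2 * L + 1) * fact (2 * L) * fact (n - L))" .
    show ?thesis
      unfolding CC unfolding True gram_poly_orthogonal[OF order_refl assms(2)] s2 ch1 ch2
      using \<open>F > 0\<close> by (simp add: divide_simps del: of_nat_add)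
  next
    case False
    \<comment> \<open>Gram orthogonality assumes ordered degrees; the other order follows by
      commuting the factors.\<close>
    have "(\<Sum>x\<le>n. gram_poly n K x * gram_poly n L x) = 0"
      using False assms(1,2) gram_poly_orthogonal[of K L n] gram_poly_orthogonal[of L K n]
      by (cases "K \<le> L") (simp_all add: mult.commute)
    then show ?thesis using False by (simp add: CC)
  qed
qed

section \<open>First and second moment of the kernel spectrum\<close>

text \<open>Makes a plain sum over \<open>x\<close> an inner product with the coefficients for
  \<open>L = 0\<close>.\<close>

lemma clebsch_gordan_scalar: "x \<le> n \<Longrightarrow>
  clebsch_gordan (real n / 2) (- (real n / 2) + real x) (real 0) 0 (real n / 2) (- (real n / 2) + real x) = 1"
  using clebsch_gordan_gram_poly[of 0 n x] by (simp add: gram_poly_def)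

text \<open>The kernel weights \<open>c L\<close> are the reciprocals of the squared norms of the
  \<open>C L\<close>. So the first moment collapses to \<open>c 0 / c 0\<close>, and the second to
  the sum of all \<open>c L\<close>, where the odd numbers add up to the square of
  \<open>n + 1\<close>.\<close>

lemma
  fixes n :: nat
  defines "j \<equiv> real n / 2"
  shows sum_kernel_eigenvalue: "(\<Sum>x\<le>n. kernel_eigenvalue j x) = 1"
    and sum_kernel_eigenvalue_power2: "(\<Sum>x\<le>n. (kernel_eigenvalue j x)\<^sup>2) = real (n + 1)"
proof -
  define C where "C L x = clebsch_gordan j (- j + real x) (real L) 0 j (- j + real x)" for L x
  define c where "c L = real (2 * L + 1) / real (n + 1)" for L
  have kernel: "kernel_eigenvalue j x = (\<Sum>L\<le>n. c L * C L x)" for x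
    by (simp add: kernel_eigenvalue_def wigner_eigenvalue_def j_def C_def c_def add.commute)
  have orth: "(\<Sum>x\<le>n. C K x * C L x) = (if K = L then 1 / c L else 0)" if "K \<le> n" "L \<le> n" for K L
    using clebsch_gordan_orthogonal[OF that] by (simp add: C_def c_def j_def)
  have pos: "c L > 0" for L by (simp add: c_def)
  have "(\<Sum>x\<le>n. kernel_eigenvalue j x) = (\<Sum>x\<le>n. \<Sum>L\<le>n. c L * (C 0 x * C L x))"
    unfolding kernel using clebsch_gordan_scalar[of _ n] by (simp add: C_def j_def)
  also have "\<dots> = (\<Sum>L\<le>n. c L * (\<Sum>x\<le>n. C 0 x * C L x))"
    by (subst sum.swap) (simp add: sum_distrib_left)
  also have "\<dots> = (\<Sum>L\<le>n. if L = 0 then 1 else 0)"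
    using pos by (intro sum.cong refl) (auto simp: orth less_imp_neq[symmetric])
  finally show "(\<Sum>x\<le>n. kernel_eigenvalue j x) = 1" by simp
  have "(\<Sum>x\<le>n. (kernel_eigenvalue j x)\<^sup>2) = (\<Sum>x\<le>n. \<Sum>K\<le>n. \<Sum>L\<le>n. c K * c L * (C K x * C L x))"
    unfolding kernel power2_eq_square sum_product by (simp add: mult_ac)
  also have "\<dots> = (\<Sum>K\<le>n. \<Sum>x\<le>n. \<Sum>L\<le>n. c K * c L * (C K x * C L x))" by (rule sum.swap)
  also have "\<dots> = (\<Sum>K\<le>n. \<Sum>L\<le>n. \<Sum>x\<le>n. c K * c L * (C K x * C L x))"
    by (intro sum.cong refl sum.swap)
  also have "\<dots> = (\<Sum>K\<le>n. \<Sum>L\<le>n. if L = K then c K else 0)"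
    unfolding sum_distrib_left[symmetric] using pos
    by (intro sum.cong refl) (auto simp: orth less_imp_neq[symmetric])
  also have "\<dots> = (\<Sum>K\<le>n. real (2 * K + 1)) / real (n + 1)"
    by (simp add: c_def sum_divide_distrib)
  also have "(\<Sum>K\<le>n. real (2 * K + 1)) = real (n + 1) * real (n + 1)"
    by (induction n) (simp_all add: algebra_simps)
  finally show "(\<Sum>x\<le>n. (kernel_eigenvalue j x)\<^sup>2) = real (n + 1)" by simp
qed

lemma sum_power2_kernel_deviation:
  fixes n :: nat
  shows "(\<Sum>x\<le>n. (kernel_eigenvalue (real n / 2) x - 1 / real (n + 1))\<^sup>2)
           = real (n + 1) - 1 / real (n + 1)"
proof -
  let ?k = "kernel_eigenvalue (real n / 2)"
  define m where "m = 1 / real (n + 1)"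
  have Nm: "real (n + 1) * m = 1" by (simp add: m_def)
  have "(\<Sum>x\<le>n. (?k x - m)\<^sup>2) = (\<Sum>x\<le>n. (?k x)\<^sup>2) - 2 * m * (\<Sum>x\<le>n. ?k x) + (\<Sum>x\<le>n. m\<^sup>2)"
    unfolding sum_distrib_left sum_subtractf[symmetric] sum.distrib[symmetric] power2_diff
    by (simp add: algebra_simps)
  then show ?thesis
    unfolding sum_kernel_eigenvalue sum_kernel_eigenvalue_power2 m_def[symmetric]
    by (simp add: power2_eq_square mult.assoc[symmetric] Nm[simplified])
qed

section \<open>Inradius of the polytope\<close>

theorem proposition3:
  fixes j Wmin :: real
  assumes "2 * j \<in> \<nat>" and "j > 0"
    and "Wmin \<in> {(MIN i\<in>spin_index j. kernel_eigenvalue j i)..1 / (2 * j + 1)}"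
    and "spectral_ball j (awb_inradius j Wmin) \<subseteq> state_simplex j"
  shows "awb_inradius j Wmin = (1 - (2 * j + 1) * Wmin) / (2 * sqrt (j * (2 * j + 1) * (j + 1)))"
proof -
  obtain n where "2 * j = real n" using assms(1) by (auto elim: Nats_cases)
  then have j: "j = real n / 2" and n: "n > 0" using assms(2) by auto
  \<comment> \<open>Besides being the entry of the mixed spectrum, \<mu> is the mean of \<Delta>,
    whose entries sum to 1; so \<Delta> - \<mu> is tangent to the trace-one hyperplane.\<close>
  define \<mu> where "\<mu> = 1 / real (n + 1)"
  define \<Delta> where "\<Delta> = kernel_eigenvalue j"
  define \<sigma> where "\<sigma> = L2_set (\<lambda>x. \<Delta> x - \<mu>) {..n}"
  have N: "real (n + 1) = 2 * j + 1" by (simp add: j)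
  have idx: "spin_index j = {..n}" by (simp add: spin_index_def j)
  have \<mu>: "1 / (2 * j + 1) = \<mu>" "(\<Sum>x\<le>n. \<mu>) = 1" by (simp_all add: \<mu>_def j)
  have sum\<Delta>: "(\<Sum>x\<le>n. \<Delta> x) = 1" by (simp add: \<Delta>_def j sum_kernel_eigenvalue)
  have \<sigma>2: "(\<Sum>x\<le>n. (\<Delta> x - \<mu>)\<^sup>2) = \<sigma>\<^sup>2" by (simp add: \<sigma>_def L2_set_def sum_nonneg)
  have "\<sigma> = sqrt (real (n + 1) - 1 / real (n + 1))"
    unfolding \<sigma>_def L2_set_def \<Delta>_def \<mu>_def j sum_power2_kernel_deviation ..
  \<comment> \<open>Expanded by \<open>2 * j + 1\<close> so that the denominator is a perfect
    square.\<close>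
  also have "real (n + 1) - 1 / real (n + 1) = 2\<^sup>2 * (j * (2 * j + 1) * (j + 1)) / (2 * j + 1)\<^sup>2"
  proof -
    define t where "t = 2 * j + 1"
    then have "t \<noteq> 0" "2\<^sup>2 * (j * t * (j + 1)) = t * (t\<^sup>2 - 1)"
      using assms(2) by (simp_all add: power2_eq_square algebra_simps)
    then show ?thesis unfolding N t_def[symmetric] by (simp add: power2_eq_square divide_simps)
  qed
  finally have \<sigma>: "\<sigma> = 2 * sqrt (j * (2 * j + 1) * (j + 1)) / (2 * j + 1)"
    using assms(2) by (simp add: real_sqrt_divide real_sqrt_mult)
  have \<sigma>_pos: "\<sigma> > 0" unfolding \<sigma> using assms(2) by (intro divide_pos_pos mult_pos_pos) auto
  \<comment> \<open>The constraint for any permutation has slack \<mu> - \<open>Wmin\<close> at the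
    centre and a tangential normal of length \<sigma>.\<close>
  define R where "R = (\<mu> - Wmin) / \<sigma>"
  have W: "Wmin \<le> \<mu>" using assms(3) by (simp add: \<mu>)
  have mixed: "L2_set (\<lambda>i. l i - mixed_spectrum j i) {..n} = L2_set (\<lambda>i. l i - \<mu>) {..n}" for l
    by (intro L2_set_cong) (simp_all add: mixed_spectrum_def idx \<mu>)
  have "spectral_ball j R \<subseteq> awb_polytope j Wmin"
  proof
    fix l assume l: "l \<in> spectral_ball j R"
    then have H: "l \<in> trace_one_hyperplane j" and suml: "(\<Sum>i\<le>n. l i) = 1"
      and dist: "L2_set (\<lambda>i. l i - \<mu>) {..n} \<le> R"
      by (simp_all add: spectral_ball_def trace_one_hyperplane_def idx mixed)
    have "Wmin \<le> (\<Sum>i\<le>n. l i * \<Delta> (\<pi> i))" if \<pi>: "\<pi> permutes {..n}" for \<pi>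
    proof -
      have sum\<pi>: "(\<Sum>i\<le>n. f (\<pi> i)) = (\<Sum>i\<le>n. f i)" for f :: "nat \<Rightarrow> real"
        using sum.permute[OF \<pi>, of f] by simp
      \<comment> \<open>Centring both factors changes the constraint functional only by the constant
        \<mu>, because all the sums involved are 1.\<close>
      have "(\<Sum>i\<le>n. (l i - \<mu>) * (\<Delta> (\<pi> i) - \<mu>))
          = (\<Sum>i\<le>n. l i * \<Delta> (\<pi> i)) - \<mu> * (\<Sum>i\<le>n. \<Delta> (\<pi> i)) - \<mu> * (\<Sum>i\<le>n. l i) + \<mu> * (\<Sum>i\<le>n. \<mu>)"
        unfolding sum_distrib_left sum.distrib[symmetric] sum_subtractf[symmetric]
        by (intro sum.cong refl) (simp add: algebra_simps)
      then have "(\<Sum>i\<le>n. l i * \<Delta> (\<pi> i)) = \<mu> + (\<Sum>i\<le>n. (l i - \<mu>) * (\<Delta> (\<pi> i) - \<mu>))"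
        unfolding sum\<pi> sum\<Delta> suml \<mu>(2) by simp
      moreover have "\<bar>\<Sum>i\<le>n. (l i - \<mu>) * (\<Delta> (\<pi> i) - \<mu>)\<bar> \<le> R * \<sigma>"
      proof -
        have "\<bar>\<Sum>i\<le>n. (l i - \<mu>) * (\<Delta> (\<pi> i) - \<mu>)\<bar>
            \<le> (\<Sum>i\<le>n. \<bar>l i - \<mu>\<bar> * \<bar>\<Delta> (\<pi> i) - \<mu>\<bar>)"
          unfolding abs_mult[symmetric] by (rule sum_abs)
        also have "\<dots> \<le> L2_set (\<lambda>i. l i - \<mu>) {..n} * L2_set (\<lambda>i. \<Delta> (\<pi> i) - \<mu>) {..n}"
          by (rule L2_set_mult_ineq)
        also have "L2_set (\<lambda>i. \<Delta> (\<pi> i) - \<mu>) {..n} = \<sigma>"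
          unfolding \<sigma>_def L2_set_def using sum\<pi>[of "\<lambda>i. (\<Delta> i - \<mu>)\<^sup>2"] by simp
        also have "L2_set (\<lambda>i. l i - \<mu>) {..n} * \<sigma> \<le> R * \<sigma>"
          using dist \<sigma>_pos by (intro mult_right_mono) simp_all
        finally show ?thesis .
      qed
      moreover have "R * \<sigma> = \<mu> - Wmin" using \<sigma>_pos by (simp add: R_def)
      ultimately show ?thesis by linarith
    qed
    with H show "l \<in> awb_polytope j Wmin" by (simp add: awb_polytope_def idx \<Delta>_def)
  qed
  moreover have "r \<le> R" if "r \<ge> 0" "spectral_ball j r \<subseteq> awb_polytope j Wmin" for r
  proof -
    \<comment> \<open>The point at distance \<open>r\<close> from the centre in the direction
      opposite to \<Delta> - \<mu>, where the constraint of the identity permutation is tightest.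
      Restriction to the index set makes it extensional.\<close>
    define l where "l = (\<lambda>i\<in>{..n}. \<mu> - r / \<sigma> * (\<Delta> i - \<mu>))"
    have "(\<Sum>i\<le>n. l i) = (\<Sum>i\<le>n. \<mu>) - r / \<sigma> * ((\<Sum>i\<le>n. \<Delta> i) - (\<Sum>i\<le>n. \<mu>))"
      unfolding sum_distrib_left sum_subtractf[symmetric] by (intro sum.cong) (simp_all add: l_def)
    then have suml: "(\<Sum>i\<le>n. l i) = 1" unfolding sum\<Delta> \<mu>(2) by simp
    then have H: "l \<in> trace_one_hyperplane j"
      by (simp add: trace_one_hyperplane_def idx l_def)
    have "L2_set (\<lambda>i. l i - \<mu>) {..n} = L2_set (\<lambda>i. - (r / \<sigma>) * (\<Delta> i - \<mu>)) {..n}"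
      by (intro L2_set_cong) (simp_all add: l_def)
    also have "\<dots> = sqrt ((r / \<sigma>)\<^sup>2 * (\<Sum>x\<le>n. (\<Delta> x - \<mu>)\<^sup>2))"
      unfolding L2_set_def sum_distrib_left by (simp only: power_mult_distrib power2_minus)
    also have "\<dots> = r"
      unfolding \<sigma>2 using \<sigma>_pos \<open>r \<ge> 0\<close> by (simp add: real_sqrt_mult)
    finally have "l \<in> awb_polytope j Wmin" using that(2) H by (auto simp: spectral_ball_def idx mixed)
    then have "Wmin \<le> (\<Sum>i\<le>n. l i * \<Delta> (id i))"
      using permutes_id[of "{..n}"] unfolding awb_polytope_def idx \<Delta>_def by blast
    also have "\<dots> = \<mu> * (\<Sum>i\<le>n. l i) + (\<Sum>i\<le>n. l i * (\<Delta> i - \<mu>))"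
      unfolding sum_distrib_left sum.distrib[symmetric] by (intro sum.cong) (simp_all add: algebra_simps)
    also have "(\<Sum>i\<le>n. l i * (\<Delta> i - \<mu>))
        = \<mu> * ((\<Sum>i\<le>n. \<Delta> i) - (\<Sum>i\<le>n. \<mu>)) - r / \<sigma> * (\<Sum>i\<le>n. (\<Delta> i - \<mu>)\<^sup>2)"
      unfolding sum_distrib_left sum_subtractf[symmetric]
      by (intro sum.cong) (simp_all add: l_def power2_eq_square algebra_simps add_divide_distrib diff_divide_distrib)
    finally have "Wmin \<le> \<mu> - r * \<sigma>"
      unfolding suml sum\<Delta> \<mu>(2) \<sigma>2 using \<sigma>_pos by (simp add: power2_eq_square)
    then show ?thesis using \<sigma>_pos by (simp add: R_def pos_le_divide_eq)
  qed
  \<comment> \<open>Needed for \<open>R\<close> itself to satisfy the predicate under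
    \<open>GREATEST\<close>; it is then its attained maximum.\<close>
  moreover have "R \<ge> 0" using W \<sigma>_pos by (simp add: R_def)
  ultimately have "awb_inradius j Wmin = R"
    unfolding awb_inradius_def by (intro Greatest_equality) auto
  also have "R = (1 - (2 * j + 1) * Wmin) / (2 * sqrt (j * (2 * j + 1) * (j + 1)))"
    unfolding R_def \<sigma> using assms(2) by (simp add: \<mu>(1)[symmetric] divide_simps) 
  finally show ?thesis .
qed

end
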